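(* For any positive real numbers $a$ and $b$, as $n\to\infty$, \[ S_{a,b}(n)\sim \frac{\Gamma(a+1)\Gamma(b+1)}{\Gamma(a+b+2)}\frac{\zeta(a+1)\zeta(b+1)}{\zeta(a+b+2)}\sigma_{a+b+1}(n). \]
   Context: For real $c$ and a positive integer $n$, $\sigma_c(n)=\sum_{d\mid n} d^c$. For positive reals $a,b$, $S_{a,b}(n):=\sum_{k=1}^{n-1}\sigma_a(k)\sigma_b(n-k)$. $\zeta$ is the Riemann zeta function and $\Gamma$ the Gamma function. *)

theory Defs
  imports "HOL-Analysis.Analysis" "HOL-Library.Landau_Symbols"
begin

definition divisor_sigma :: "real \<Rightarrow> nat \<Rightarrow> real" where
  "divisor_sigma c n = (\<Sum>d | d dvd n. real d powr c)"

definition S :: "real \<Rightarrow> real \<Rightarrow> nat \<Rightarrow> real" where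
  "S a b n = (\<Sum>k=1..<n. divisor_sigma a k * divisor_sigma b (n - k))"

(* The Riemann zeta function, only on the half-line s > 1, where it is given by its
   Dirichlet series; for s \<le> 1 the value is meaningless. The index is shifted so that
   the series starts at 1. *)
definition zeta :: "real \<Rightarrow> real" where
  "zeta s = (\<Sum>n. 1 / real (Suc n) powr s)"

lemma zeta_sums:
  assumes "s > 1"
  shows "(\<lambda>n. 1 / real (Suc n) powr s) sums zeta s"
proof -
  have "summable (\<lambda>n. real n powr (- s))"
    using assms by (simp add: summable_real_powr_iff)
  then have "summable (\<lambda>n. real (Suc n) powr (- s))"
    by (subst summable_Suc_iff)
  then have "summable (\<lambda>n. 1 / real (Suc n) powr s)"
    by (simp only: powr_minus_divide)
  then show ?thesis
    unfolding zeta_def by (rule summable_sums)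
qed

end

(* Write sigma_a(k) = k^a * sigma_{-a}(k), so that S_{a,b}(n) / n^(a+b+1) is the mean over k < n of
   w(k/n) sigma_{-a}(k) sigma_{-b}(n-k) with w(x) = x^a (1-x)^b. Restrict both divisor sums to divisors
   d, e <= D. By Cauchy-Schwarz the error is controlled by mean squares of the tails, which are at most
   sum_{x,y > D} gcd(x,y) (xy)^(-a-1); this double series converges for every a > 0 (the bound
   by the trivial count of k for each pair d, e would need a + b > 1), so the error is small uniformly
   in n. For fixed d, e the conditions d | k and e | n-k are either contradictory (gcd(d,e) does not
   divide n) or define one residue class modulo lcm(d,e), along which the Riemann sum of w tends to
   B(a+1,b+1) / lcm(d,e), uniformly in the class. The resulting main term is B(a+1,b+1) times
   sum_{gcd(d,e) | n} gcd(d,e) d^(-a-1) e^(-b-1), and extracting the gcd evaluates it as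
   sigma_{-a-b-1}(n) zeta(a+1) zeta(b+1) / zeta(a+b+2), which is bounded away from 0. *)
theory Submission
  imports Defs "HOL-Number_Theory.Cong"
begin

section \<open>Double series over pairs with given greatest common divisor\<close>

lemma has_sum_zeta:
  assumes "s > 1"
  shows "((\<lambda>n::nat. real n powr - s) has_sum zeta s) {0<..}"
proof -
  have "((\<lambda>n. 1 / real (Suc n) powr s) has_sum zeta s) UNIV"
    by (rule sums_nonneg_imp_has_sum[OF zeta_sums[OF assms]]) auto
  moreover have "bij_betw Suc UNIV {0<..}"
    by (rule bij_betwI[where g = "\<lambda>n. n - 1"]) auto
  ultimately show ?thesis
    by (subst has_sum_reindex_bij_betw[symmetric, where g = Suc])
       (auto simp: powr_minus_divide)
qed

lemma zeta_ge_1: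
  assumes "s > 1"
  shows "zeta s \<ge> 1"
  using finite_sum_le_infsum[of "\<lambda>n::nat. real n powr - s" "{0<..}" "{1}"]
    has_sum_zeta[OF assms] by (auto simp: has_sum_iff)

text \<open>Nonnegativity is what makes iterated summation enough: convergent sums of the row sums
  give unconditional summability on the product.\<close>

lemma has_sum_nonneg_Times:
  fixes f :: "'a \<Rightarrow> real" and g :: "'b \<Rightarrow> real"
  assumes f: "(f has_sum a) A" "\<And>x. x \<in> A \<Longrightarrow> f x \<ge> 0"
    and g: "(g has_sum b) B" "\<And>y. y \<in> B \<Longrightarrow> g y \<ge> 0"
  shows "((\<lambda>(x,y). f x * g y) has_sum (a * b)) (A \<times> B)"
proof (rule has_sum_SigmaI)
  have inner: "((\<lambda>y. case (x, y) of (x, y) \<Rightarrow> f x * g y) has_sum f x * b) B" for x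
    using has_sum_cmult_right[OF g(1)] by simp
  then show "((\<lambda>y. case (x, y) of (x, y) \<Rightarrow> f x * g y) has_sum f x * b) B" for x .
  show outer: "((\<lambda>x. f x * b) has_sum a * b) A"
    using has_sum_cmult_left[OF f(1)] by simp
  show "(\<lambda>(x,y). f x * g y) summable_on A \<times> B"
    by (rule summable_on_SigmaI[OF inner]) (use outer f(2) g(2) in \<open>auto simp: has_sum_iff\<close>)
qed

definition coprime_pairs :: "(nat \<times> nat) set" where
  "coprime_pairs = {(x, y). x > 0 \<and> y > 0 \<and> coprime x y}"

text \<open>Extraction of the gcd, inverted by dividing both entries by it. This is the change of
  variables behind \<open>has_sum_gcd\<close>.\<close>

lemma bij_betw_coprime_pairs:
  "bij_betw (\<lambda>(g, x, y). (g * x, g * y)) ({0<..} \<times> coprime_pairs) ({0<..} \<times> {0<..})"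
proof (rule bij_betwI[where g = "\<lambda>(x, y). (gcd x y, x div gcd x y, y div gcd x y)"])
  show "(\<lambda>(x, y). (gcd x y, x div gcd x y, y div gcd x y)) \<in>
      {0<..} \<times> {0<..} \<rightarrow> {0<..} \<times> coprime_pairs"
    by (auto simp: coprime_pairs_def div_gcd_coprime div_greater_zero_iff gcd_le1_nat gcd_le2_nat)
qed (auto simp: coprime_pairs_def gcd_mult_distrib_nat[symmetric])

lemma summable_coprime_pairs:
  assumes "s > 1" "t > 1"
  shows "(\<lambda>(x, y). real x powr - s * real y powr - t) summable_on coprime_pairs"
proof (rule summable_on_subset)
  show "(\<lambda>(x, y). real x powr - s * real y powr - t) summable_on {0<..} \<times> {0<..}"
    using has_sum_nonneg_Times[OF has_sum_zeta[OF assms(1)] _ has_sum_zeta[OF assms(2)]]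
    by (auto simp: has_sum_iff)
qed (auto simp: coprime_pairs_def)

text \<open>Writing a pair as \<open>g\<close> times a coprime pair splits off
  \<open>g powr - (s + t)\<close>, so the double series factors. The coprime factor does not depend
  on \<open>h\<close>; below, \<open>h\<close> is the constant 1, the identity, and the identity cut
  off to divisors of \<open>n\<close>.\<close>

lemma has_sum_gcd:
  fixes h :: "nat \<Rightarrow> real"
  defines "K \<equiv> \<lambda>s t. \<Sum>\<^sub>\<infinity>(x, y)\<in>coprime_pairs. real x powr - s * real y powr - t"
  assumes st: "s > 1" "t > 1" and h: "\<And>g. h g \<ge> 0"
    and H: "((\<lambda>g. h g * real g powr - (s + t)) has_sum c) {0<..}"
  shows "((\<lambda>(x, y). h (gcd x y) * (real x powr - s * real y powr - t)) has_sum (c * K s t))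
           ({0<..} \<times> {0<..})"
proof (subst has_sum_reindex_bij_betw[OF bij_betw_coprime_pairs, symmetric])
  have "((\<lambda>(g, p). h g * real g powr - (s + t) *
      (case p of (x, y) \<Rightarrow> real x powr - s * real y powr - t)) has_sum (c * K s t))
           ({0<..} \<times> coprime_pairs)"
    unfolding K_def
    by (intro has_sum_nonneg_Times H has_sum_infsum summable_coprime_pairs st) (auto simp: h)
  then show "((\<lambda>p. case (case p of (g, x, y) \<Rightarrow> (g * x, g * y)) of
        (x, y) \<Rightarrow> h (gcd x y) * (real x powr - s * real y powr - t)) has_sum (c * K s t))
           ({0<..} \<times> coprime_pairs)"
    by (rule has_sum_cong[THEN iffD1, rotated])
       (auto simp: coprime_pairs_def gcd_mult_distrib_nat[symmetric] powr_mult powr_add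
          minus_diff_eq powr_diff powr_minus field_simps)
qed

text \<open>For \<open>h\<close> constant 1 the double series is also a plain product of two zeta
  series; comparing both evaluations determines the sum over coprime pairs.\<close>

lemma zeta_mult:
  assumes "s > 1" "t > 1"
  shows "(\<Sum>\<^sub>\<infinity>(x, y)\<in>coprime_pairs. real x powr - s * real y powr - t) =
           zeta s * zeta t / zeta (s + t)"
proof -
  have "zeta (s + t) \<ge> 1"
    using assms by (intro zeta_ge_1) auto
  moreover have "zeta s * zeta t = zeta (s + t) *
      (\<Sum>\<^sub>\<infinity>(x, y)\<in>coprime_pairs. real x powr - s * real y powr - t)"
    using has_sum_nonneg_Times[OF has_sum_zeta[OF assms(1)] _ has_sum_zeta[OF assms(2)]]
      has_sum_gcd[OF assms, of "\<lambda>_. 1"] has_sum_zeta[of "s + t"] assms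
    by (intro has_sum_unique) auto
  ultimately show ?thesis
    by (simp add: field_simps)
qed

lemma mult_powr_minus_add:
  "real g * real g powr - (s + t) = real g powr (1 - s - t)"
  by (simp add: powr_mult_base algebra_simps)

text \<open>With \<open>h\<close> the identity, the series over \<open>g\<close> is that of
  \<open>zeta (s + t - 1)\<close>, and \<open>s + t - 1 > 1\<close>.\<close>

lemma summable_gcd:
  assumes "s > 1" "t > 1"
  shows "(\<lambda>(x, y). real (gcd x y) * (real x powr - s * real y powr - t))
           summable_on {0<..} \<times> {0<..}"
proof -
  have "((\<lambda>g. real g * real g powr - (s + t)) has_sum zeta (s + t - 1)) {0<..}"
    using has_sum_zeta[of "s + t - 1"] assms
    unfolding mult_powr_minus_add by (simp add: algebra_simps)
  from has_sum_gcd[OF assms _ this] show ?thesis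
    by (auto simp: has_sum_iff)
qed

text \<open>Cutting \<open>h\<close> off to divisors of \<open>n\<close> turns the series over
  \<open>g\<close> into a finite divisor sum. This is the arithmetic factor of the main
  term.\<close>

lemma has_sum_gcd_dvd:
  assumes "s > 1" "t > 1" "n > 0"
  shows "((\<lambda>(x, y). if gcd x y dvd n then real (gcd x y) * (real x powr - s * real y powr - t) else 0)
           has_sum (divisor_sigma (1 - s - t) n * (zeta s * zeta t / zeta (s + t)))) ({0<..} \<times> {0<..})"
proof -
  have "((\<lambda>g. real g powr (1 - s - t)) has_sum divisor_sigma (1 - s - t) n) {d. d dvd n}"
    unfolding divisor_sigma_def using assms by (intro has_sum_finite) auto
  \<comment> \<open>All divisors of a positive \<open>n\<close> are positive, so passing to
    \<open>{0<..}\<close> only adds zero terms.\<close>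
  also have "?this \<longleftrightarrow> ((\<lambda>g. (if g dvd n then real g else 0) * real g powr - (s + t))
               has_sum divisor_sigma (1 - s - t) n) {0<..}"
    using assms(3)
    by (intro has_sum_cong_neutral) (auto simp: mult_powr_minus_add simp del: minus_add_distrib)
  finally have "((\<lambda>g. (if g dvd n then real g else 0) * real g powr - (s + t))
               has_sum divisor_sigma (1 - s - t) n) {0<..}" .
  then have "((\<lambda>(x, y). (if gcd x y dvd n then real (gcd x y) else 0) *
                 (real x powr - s * real y powr - t))
           has_sum (divisor_sigma (1 - s - t) n * (zeta s * zeta t / zeta (s + t)))) ({0<..} \<times> {0<..})"
    unfolding zeta_mult[OF assms(1,2), symmetric] by (intro has_sum_gcd assms(1,2)) auto
  then show ?thesis
    by (rule has_sum_cong[THEN iffD1, rotated]) auto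
qed

section \<open>Mean squares of truncated divisor sums\<close>

text \<open>The set \<open>A\<close> will be all positive integers, those up to a cutoff
  \<open>D\<close>, or those beyond it.\<close>

definition truncated_sigma :: "nat set \<Rightarrow> real \<Rightarrow> nat \<Rightarrow> real" where
  "truncated_sigma A c k = (\<Sum>d | d dvd k \<and> d \<in> A. real d powr c)"

text \<open>The involution sending \<open>d\<close> to \<open>k div d\<close>. It makes the exponent
  negative, so that large divisors carry little weight.\<close>

lemma divisor_sigma_eq_truncated:
  assumes "k > 0"
  shows "divisor_sigma a k = real k powr a * truncated_sigma {0<..} (- a) k"
proof -
  have "divisor_sigma a k = (\<Sum>d | d dvd k \<and> d \<in> {0<..}. real k powr a * real d powr - a)"
    unfolding divisor_sigma_def using assms
    by (intro sum.reindex_bij_witness[where i = "\<lambda>d. k div d" and j = "\<lambda>d. k div d"])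
       (auto simp: powr_mult powr_minus field_simps dvd_def intro!: Nat.gr0I)
  then show ?thesis
    by (simp add: truncated_sigma_def sum_distrib_left)
qed

lemma divisor_sigma_uminus:
  assumes "n > 0"
  shows "divisor_sigma c n = real n powr c * divisor_sigma (- c) n"
proof -
  have "divisor_sigma (- c) n = truncated_sigma {0<..} (- c) n"
    unfolding divisor_sigma_def truncated_sigma_def
    using assms by (intro sum.cong) (auto intro: Nat.gr0I)
  then show ?thesis
    using divisor_sigma_eq_truncated[OF assms] by simp
qed

lemma divisor_sigma_ge_1:
  assumes "n > 0"
  shows "divisor_sigma c n \<ge> 1"
  unfolding divisor_sigma_def using assms
  using member_le_sum[of 1 "{d. d dvd n}" "\<lambda>d. real d powr c"] by auto

lemma truncated_sigma_nonneg: "truncated_sigma A c k \<ge> 0"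
  by (auto simp: truncated_sigma_def intro: sum_nonneg)

lemma truncated_sigma_Un:
  assumes "k > 0" "A \<inter> B = {}"
  shows "truncated_sigma (A \<union> B) c k = truncated_sigma A c k + truncated_sigma B c k"
  unfolding truncated_sigma_def using assms
  by (subst sum.union_disjoint[symmetric]) (auto intro!: sum.cong)

text \<open>A divisor of \<open>k\<close> is below \<open>n\<close>, so the range of summation can
  be made independent of \<open>k\<close>; this permits interchanging the sums over \<open>k\<close>
  and over divisors.\<close>

lemma truncated_sigma_altdef:
  assumes "k \<in> {1..<n}" "A \<subseteq> {0<..}"
  shows "truncated_sigma A c k = (\<Sum>d\<in>A \<inter> {..<n}. if d dvd k then real d powr c else 0)"
  unfolding truncated_sigma_def using assms
  by (subst sum.inter_filter[symmetric]) (auto intro!: sum.cong dest: dvd_imp_le)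

text \<open>Since \<open>k = 0\<close> is left out, no additive 1 appears. The bound thus stays
  proportional to \<open>1 / L\<close> even for \<open>L > n\<close>, which the convergent series
  needs.\<close>

lemma card_multiples_le:
  assumes "L > 0"
  shows "real (card {k \<in> {1..<n}. L dvd k}) \<le> real n / real L"
proof -
  have "{k \<in> {1..<n}. L dvd k} \<subseteq> (\<lambda>j. L * j) ` {1..n div L}"
  proof
    fix k assume "k \<in> {k \<in> {1..<n}. L dvd k}"
    then obtain j where "k = L * j" "j > 0" "L * j < n"
      by (auto elim!: dvdE intro: Nat.gr0I)
    then show "k \<in> (\<lambda>j. L * j) ` {1..n div L}"
      using assms by (auto simp: less_eq_div_iff_mult_less_eq mult.commute)
  qed
  then have "card {k \<in> {1..<n}. L dvd k} \<le> n div L"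
    using surj_card_le[of "{1..n div L}"] by simp
  also have "real (n div L) \<le> real n / real L"
    by (simp add: of_nat_div_le_of_nat)
  finally show ?thesis by simp
qed

lemma inverse_lcm:
  assumes "x > 0" "y > 0"
  shows "1 / real (lcm x y) = real (gcd x y) / (real x * real y)"
proof -
  have "real (gcd x y) * real (lcm x y) = real x * real y"
    by (metis of_nat_mult prod_gcd_lcm_nat)
  then show ?thesis
    using assms by (simp add: field_simps)
qed

text \<open>Through 1 / lcm = gcd / (x y), the density of the multiples of the lcm turns the divisor
  weights into terms of the gcd series.\<close>

lemma weight_div_lcm:
  assumes "x > 0" "y > 0"
  shows "real x powr - a * real y powr - b / real (lcm x y) =
           real (gcd x y) * (real x powr - (a + 1) * real y powr - (b + 1))"
  using inverse_lcm[OF assms] assms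
  by (simp add: powr_diff powr_minus powr_add field_simps)

text \<open>Expand the square: \<open>x\<close> and \<open>y\<close> both divide \<open>k\<close>
  iff their lcm does, which happens at most \<open>n / lcm x y\<close> times. Nonnegative terms then
  allow extending the sum to all of \<open>A \<times> A\<close>, so the mean square is bounded
  independently of \<open>n\<close>.\<close>

lemma sum_truncated_sigma_sq_le:
  assumes "a > 0" "A \<subseteq> {0<..}"
  shows "(\<Sum>k=1..<n. (truncated_sigma A (- a) k)\<^sup>2) \<le> real n *
           (\<Sum>\<^sub>\<infinity>(x, y)\<in>A \<times> A. real (gcd x y) * (real x powr - (a + 1) * real y powr - (a + 1)))"
proof -
  define F where "F = (\<lambda>(x, y). real (gcd x y) * (real x powr - (a + 1) * real y powr - (a + 1)))"
  define B where "B = A \<inter> {..<n}"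
  have pos: "x > 0" if "x \<in> B" for x
    using that assms unfolding B_def by auto
  have "(\<Sum>k=1..<n. (truncated_sigma A (- a) k)\<^sup>2) =
        (\<Sum>k=1..<n. \<Sum>(x,y)\<in>B \<times> B. if lcm x y dvd k then real x powr - a * real y powr - a else 0)"
    unfolding B_def using assms(2)
    by (intro sum.cong refl)
       (auto simp: truncated_sigma_altdef power2_eq_square sum_product sum.cartesian_product
          intro!: sum.cong)
  also have "\<dots> = (\<Sum>(x,y)\<in>B \<times> B. \<Sum>k=1..<n. if lcm x y dvd k then real x powr - a * real y powr - a else 0)"
    by (subst sum.swap) (simp add: case_prod_unfold)
  also have "\<dots> = (\<Sum>(x,y)\<in>B \<times> B. real (card {k \<in> {1..<n}. lcm x y dvd k}) * (real x powr - a * real y powr - a))"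
    by (simp flip: sum.inter_filter)
  also have "\<dots> \<le> (\<Sum>(x,y)\<in>B \<times> B. real n / real (lcm x y) * (real x powr - a * real y powr - a))"
    using pos unfolding case_prod_unfold
    by (intro sum_mono mult_right_mono card_multiples_le lcm_pos_nat) auto
  also have "\<dots> = (\<Sum>p\<in>B \<times> B. real n * F p)"
    using pos by (intro sum.cong) (auto simp: F_def simp del: minus_add_distrib simp flip: weight_div_lcm)
  also have "\<dots> \<le> real n * infsum F (A \<times> A)"
    unfolding sum_distrib_left[symmetric] F_def using assms
    by (intro mult_left_mono finite_sum_le_infsum summable_on_subset[OF summable_gcd])
       (auto simp: B_def)
  finally show ?thesis unfolding F_def .
qed

section \<open>Riemann sums along residue classes\<close>

text \<open>The Beta integrand on [0, 1], extended by zero. For positive exponents this is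
  continuous on the whole line, and sample points outside the interval contribute nothing.\<close>

definition beta_weight :: "real \<Rightarrow> real \<Rightarrow> real \<Rightarrow> real" where
  "beta_weight a b x = max 0 x powr a * max 0 (1 - x) powr b"

lemma beta_weight_nonneg: "beta_weight a b x \<ge> 0"
  by (simp add: beta_weight_def)

lemma beta_weight_le_1:
  assumes "a > 0" "b > 0" "x \<ge> 0" "x \<le> 1"
  shows "beta_weight a b x \<le> 1"
  unfolding beta_weight_def using assms
  by (intro mult_le_one powr_le1) auto

lemma continuous_beta_weight:
  assumes "a > 0" "b > 0"
  shows "continuous_on X (beta_weight a b)"
  unfolding beta_weight_def using assms
  by (intro continuous_intros continuous_on_powr') auto

lemma beta_weight_eq_0: "x \<le> 0 \<or> x \<ge> 1 \<Longrightarrow> beta_weight a b x = 0"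
  by (auto simp: beta_weight_def max_def)

lemma has_integral_beta_weight:
  assumes "a > 0" "b > 0"
  shows "(beta_weight a b has_integral Beta (a + 1) (b + 1)) {0..1}"
  using has_integral_Beta_real[of "a + 1" "b + 1"] assms
  by (rule_tac has_integral_eq[rotated]) (auto simp: beta_weight_def max_def)

text \<open>Because \<open>W\<close> vanishes off (0, 1), the progression may start at
  \<open>j = 0\<close> and overshoot \<open>n\<close>; the number of terms then does not depend on
  \<open>c\<close>.\<close>

lemma sum_residue_class:
  fixes W :: "real \<Rightarrow> real"
  assumes "c < L" and W0: "\<And>x. x \<le> 0 \<or> x \<ge> 1 \<Longrightarrow> W x = 0"
  shows "(\<Sum>k | k \<in> {1..<n} \<and> k mod L = c. W (real k / real n)) =
           (\<Sum>j<n div L + 1. W ((real c + real j * real L) / real n))"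
proof -
  let ?h = "\<lambda>j. c + j * L"
  have "(\<Sum>k | k \<in> {1..<n} \<and> k mod L = c. W (real k / real n)) =
        (\<Sum>k\<in>?h ` {..<n div L + 1}. W (real k / real n))"
  proof (rule sum.mono_neutral_left)
    show "{k. k \<in> {1..<n} \<and> k mod L = c} \<subseteq> ?h ` {..<n div L + 1}"
    proof
      fix k assume k: "k \<in> {k. k \<in> {1..<n} \<and> k mod L = c}"
      then have "k = ?h (k div L)" "k div L \<le> n div L"
        using div_mult_mod_eq[of k L] by (auto intro: div_le_mono simp: add.commute)
      then show "k \<in> ?h ` {..<n div L + 1}"
        by (intro image_eqI[of _ _ "k div L"]) auto
    qed
    show "\<forall>k\<in>?h ` {..<n div L + 1} - {k. k \<in> {1..<n} \<and> k mod L = c}. W (real k / real n) = 0"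
    proof
      fix k assume "k \<in> ?h ` {..<n div L + 1} - {k. k \<in> {1..<n} \<and> k mod L = c}"
      then have "k = 0 \<or> k \<ge> n"
        using assms(1) by (auto simp: not_less_eq_eq)
      \<comment> \<open>For \<open>n = 0\<close> the quotient is 0 by convention, and
        \<open>W\<close> vanishes there too.\<close>
      then show "W (real k / real n) = 0"
        by (cases "n = 0") (auto intro!: W0)
    qed
  qed auto
  also have "\<dots> = (\<Sum>j<n div L + 1. W (real (?h j) / real n))"
    using assms(1) by (subst sum.reindex) (auto simp: inj_on_def)
  finally show ?thesis by simp
qed

lemma integral_sum_steps:
  fixes W :: "real \<Rightarrow> real"
  assumes "continuous_on UNIV W" "h \<ge> 0"
  shows "integral {0..real m * h} W = (\<Sum>j<m. integral {real j * h..real (Suc j) * h} W)"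
proof (induction m)
  case (Suc m)
  have "integral {0..real m * h} W + integral {real m * h..real (Suc m) * h} W =
        integral {0..real (Suc m) * h} W"
    using assms
    by (intro Henstock_Kurzweil_Integration.integral_combine integrable_continuous_interval
          continuous_on_subset[OF assms(1)] mult_right_mono) auto
  then show ?case
    using Suc by simp
qed auto

lemma integral_point_bound:
  fixes W :: "real \<Rightarrow> real"
  assumes "continuous_on {u..v} W" "u \<le> v" "e \<ge> 0" "\<And>t. t \<in> {u..v} \<Longrightarrow> \<bar>W t - y\<bar> \<le> e"
  shows "\<bar>integral {u..v} W - (v - u) * y\<bar> \<le> e * (v - u)"
proof -
  have "((\<lambda>t. W t - y) has_integral (integral {u..v} W - (v - u) * y)) {u..v}"
    using assms(1,2) has_integral_const_real[of y u v]
    by (intro has_integral_diff integrable_integral integrable_continuous_interval) auto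
  from has_integral_bound_real[OF assms(3) finite.emptyI this] assms(2,4) show ?thesis
    by auto
qed

text \<open>The \<open>j\<close>-th point of the class, divided by \<open>n\<close>, lies in the
  \<open>j\<close>-th interval of length \<open>L / n\<close>, so this is a tagged Riemann sum. The
  modulus of continuity of \<open>W\<close> does not depend on \<open>c\<close>, which gives
  uniformity over the classes.\<close>

lemma residue_class_riemann_sum:
  fixes W :: "real \<Rightarrow> real"
  assumes cont: "continuous_on UNIV W" and W0: "\<And>x. x \<le> 0 \<or> x \<ge> 1 \<Longrightarrow> W x = 0"
    and I: "(W has_integral I) {0..1}" and L: "L > 0" and e: "e > 0"
  shows "\<forall>\<^sub>F n in at_top. \<forall>c<L.
           \<bar>(\<Sum>k | k \<in> {1..<n} \<and> k mod L = c. W (real k / real n)) / real n - I / real L\<bar> \<le> e"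
proof -
  \<comment> \<open>The last interval may overshoot 1, by at most \<open>L / n \<le> 1\<close>;
    hence the domain reaches to 2.\<close>
  have "uniformly_continuous_on {0..2} W"
    by (intro compact_uniformly_continuous continuous_on_subset[OF cont]) auto
  then obtain \<delta> where \<delta>: "\<delta> > 0"
    "\<And>x y. x \<in> {0..2} \<Longrightarrow> y \<in> {0..2} \<Longrightarrow> dist y x < \<delta> \<Longrightarrow> dist (W y) (W x) < e / 2"
    using e unfolding uniformly_continuous_on_def by (metis half_gt_zero)
  have "\<forall>\<^sub>F n in at_top. real L / real n < \<delta>"
    using lim_const_over_n[of "real L"] \<delta>(1) by (rule order_tendstoD)
  then show ?thesis
    using eventually_ge_at_top[of "max L 1"]
  proof eventually_elim
    case (elim n)
    define h where "h = real L / real n"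
    define N where "N = n div L + 1"
    have h: "h > 0" "h < \<delta>"
      using elim L by (auto simp: h_def)
    have "n < N * L" "N * L \<le> n + L"
      using L by (auto simp: N_def dividend_less_div_times)
    then have Nh: "real N * h \<ge> 1" "real N * h \<le> 2"
      using elim L unfolding h_def
      by (auto simp: field_simps simp flip: of_nat_mult of_nat_add)
    \<comment> \<open>Beyond 1 the integrand is zero, so the overshoot does not change the
      integral.\<close>
    have "(W has_integral I) {0..real N * h}"
      by (rule has_integral_on_superset[OF I]) (use Nh W0 in auto)
    then have I_eq: "I = (\<Sum>j<N. integral {real j * h..real (Suc j) * h} W)"
      using integral_sum_steps[OF cont, of h N] h by (simp add: has_integral_iff)
    show ?case
    proof (intro allI impI)
      fix c assume c: "c < L"
      have "\<bar>integral {real j * h..real (Suc j) * h} W - h * W ((real c + real j * real L) / real n)\<bar>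
              \<le> e / 2 * h" if j: "j < N" for j
      proof -
        let ?x = "(real c + real j * real L) / real n"
        have x: "?x \<in> {real j * h..real (Suc j) * h}"
          using c elim by (auto simp: h_def field_simps)
        have sub: "{real j * h..real (Suc j) * h} \<subseteq> {0..2}"
        proof -
          have "real (Suc j) * h \<le> real N * h"
            using j h by (intro mult_right_mono) auto
          then have "real (Suc j) * h \<le> 2"
            using Nh by linarith
          moreover have "0 \<le> real j * h"
            using h by simp
          ultimately show ?thesis
            by (metis atLeastatMost_subset_iff)
        qed
        have close: "\<bar>W t - W ?x\<bar> \<le> e / 2" if t: "t \<in> {real j * h..real (Suc j) * h}" for t
        proof -
          have "dist t ?x \<le> h"
            using x t by (auto simp: dist_real_def algebra_simps abs_le_iff)
          then have "dist t ?x < \<delta>"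
            using h by simp
          then have "dist (W t) (W ?x) < e / 2"
            using sub x t by (intro \<delta>(2)) blast+
          then show ?thesis
            by (simp only: dist_real_def less_imp_le)
        qed
        have step: "real (Suc j) * h - real j * h = h"
          by (simp add: algebra_simps)
        have "\<bar>integral {real j * h..real (Suc j) * h} W - (real (Suc j) * h - real j * h) * W ?x\<bar>
                \<le> e / 2 * (real (Suc j) * h - real j * h)"
          using e h by (intro integral_point_bound close continuous_on_subset[OF cont] mult_right_mono) auto
        then show ?thesis unfolding step .
      qed
      then have "\<bar>\<Sum>j<N. integral {real j * h..real (Suc j) * h} W
            - h * W ((real c + real j * real L) / real n)\<bar> \<le> (\<Sum>j<N. e / 2 * h)"
        by (intro order.trans[OF sum_abs] sum_mono) auto
      \<comment> \<open>An error of \<open>e / 2\<close> per unit length accumulates over a total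
        length of at most 2.\<close>
      also have "(\<Sum>j<N. e / 2 * h) = (real N * h) * (e / 2)" by simp
      also have "\<dots> \<le> 2 * (e / 2)"
        using Nh e by (intro mult_right_mono) auto
      finally have bound: "\<bar>\<Sum>j<N. integral {real j * h..real (Suc j) * h} W
            - h * W ((real c + real j * real L) / real n)\<bar> \<le> 2 * (e / 2)" .
      let ?S = "\<Sum>k | k \<in> {1..<n} \<and> k mod L = c. W (real k / real n)"
      have S: "?S = (\<Sum>j<N. W ((real c + real j * real L) / real n))"
        unfolding N_def by (rule sum_residue_class[OF c]) (rule W0)
      have "I - h * ?S = (\<Sum>j<N. integral {real j * h..real (Suc j) * h} W
            - h * W ((real c + real j * real L) / real n))"
        unfolding I_eq S by (simp only: sum_distrib_left sum_subtractf)
      with bound have *: "\<bar>I - h * ?S\<bar> \<le> e"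
        by simp
      have "?S / real n - I / real L = (h * ?S - I) / real L"
        using L elim by (simp add: h_def field_simps)
      also have "\<bar>\<dots>\<bar> = \<bar>I - h * ?S\<bar> / real L"
        by (simp add: abs_minus_commute)
      also have "\<dots> \<le> e / 1"
        using * L e by (intro frac_le) auto
      finally show "\<bar>?S / real n - I / real L\<bar> \<le> e"
        by simp
    qed
  qed
qed

section \<open>Simultaneous divisibility conditions on k and n - k\<close>

lemma two_divisibility_residue_class:
  fixes d e n :: nat
  assumes "d > 0" "e > 0" "gcd d e dvd n"
  obtains c where "c < lcm d e" "\<And>k. k < n \<Longrightarrow> d dvd k \<and> e dvd n - k \<longleftrightarrow> k mod lcm d e = c"
proof -
  \<comment> \<open>Chinese remaindering for moduli that need not be coprime: \<open>d * x\<close>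
    is a multiple of \<open>d\<close> congruent to \<open>n\<close> modulo \<open>e\<close>, and it
    exists because the gcd divides \<open>n\<close>.\<close>
  from assms(3) obtain x where x: "[d * x = n] (mod e)"
    using cong_solve_dvd_nat by blast
  let ?c = "d * x mod lcm d e"
  have "d dvd k \<and> e dvd n - k \<longleftrightarrow> k mod lcm d e = ?c" if "k < n" for k
  proof -
    have "d dvd k \<longleftrightarrow> [k = d * x] (mod d)"
      by (simp add: cong_def dvd_eq_mod_eq_0)
    \<comment> \<open>As \<open>k < n\<close>, the natural subtraction is genuine and the condition
      says that \<open>k\<close> and \<open>n\<close> agree modulo \<open>e\<close>.\<close>
    moreover have "e dvd n - k \<longleftrightarrow> [k = d * x] (mod e)"
      using that x by (metis cong_altdef_nat cong_sym cong_trans less_imp_le)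
    moreover have "[k = d * x] (mod d) \<and> [k = d * x] (mod e) \<longleftrightarrow> [k = d * x] (mod lcm d e)"
    proof -
      have "[k = d * x] (mod m) \<longleftrightarrow> int m dvd int k - int (d * x)" for m
        by (metis cong_iff_dvd_diff cong_int_iff)
      then show ?thesis
        by (metis lcm_int_int_eq lcm_least_iff)
    qed
    ultimately show ?thesis by (simp add: cong_def)
  qed
  then show ?thesis
    using assms that[of ?c] by (auto simp: lcm_pos_nat)
qed

lemma two_divisibility_riemann_sum:
  fixes W :: "real \<Rightarrow> real"
  assumes cont: "continuous_on UNIV W" and W0: "\<And>x. x \<le> 0 \<or> x \<ge> 1 \<Longrightarrow> W x = 0"
    and I: "(W has_integral I) {0..1}" and de: "d > 0" "e > 0"
  shows "(\<lambda>n. (\<Sum>k | k \<in> {1..<n} \<and> d dvd k \<and> e dvd n - k. W (real k / real n)) / real n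
           - (if gcd d e dvd n then I / real (lcm d e) else 0)) \<longlonglongrightarrow> 0"
proof (rule tendstoI)
  fix \<epsilon> :: real assume \<epsilon>: "\<epsilon> > 0"
  let ?L = "lcm d e"
  have L: "?L > 0"
    using de by (simp add: lcm_pos_nat)
  have "\<forall>\<^sub>F n in at_top. \<forall>c<?L. \<bar>(\<Sum>k | k \<in> {1..<n} \<and> k mod ?L = c. W (real k / real n)) / real n
          - I / real ?L\<bar> \<le> \<epsilon> / 2"
    using \<epsilon> by (intro residue_class_riemann_sum[OF cont W0 I L]) auto
  then show "\<forall>\<^sub>F n in at_top. dist ((\<Sum>k | k \<in> {1..<n} \<and> d dvd k \<and> e dvd n - k. W (real k / real n)) / real n
           - (if gcd d e dvd n then I / real ?L else 0)) 0 < \<epsilon>"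
  proof eventually_elim
    case (elim n)
    show ?case
    proof (cases "gcd d e dvd n")
      case True
      \<comment> \<open>The residue \<open>c\<close> varies with \<open>n\<close>; this is why the
        Riemann sum estimate has to be uniform over classes.\<close>
      obtain c where c: "c < ?L"
        "\<And>k. k < n \<Longrightarrow> d dvd k \<and> e dvd n - k \<longleftrightarrow> k mod ?L = c"
        using two_divisibility_residue_class[OF de True] by metis
      have "{k. k \<in> {1..<n} \<and> d dvd k \<and> e dvd n - k} = {k. k \<in> {1..<n} \<and> k mod ?L = c}"
        using c(2) by auto
      moreover have "\<bar>(\<Sum>k | k \<in> {1..<n} \<and> k mod ?L = c. W (real k / real n)) / real n
          - I / real ?L\<bar> \<le> \<epsilon> / 2"
        using elim c(1) by blast
      ultimately show ?thesis
        using True \<epsilon> by (simp only: dist_real_def if_True)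
    next
      case False
      \<comment> \<open>Otherwise the gcd would divide \<open>k + (n - k) = n\<close>.\<close>
      have "\<not> (d dvd k \<and> e dvd n - k)" if "k < n" for k
        using False that
        by (metis dvd_add gcd_dvd1 gcd_dvd2 dvd_trans le_add_diff_inverse less_imp_le)
      then have "{k. k \<in> {1..<n} \<and> d dvd k \<and> e dvd n - k} = {}"
        by auto
      then show ?thesis
        using False \<epsilon> by (simp only: sum.empty) auto
    qed
  qed
qed

section \<open>The weighted convolution\<close>

text \<open>Every finite set of pairs lies in some box, so the sums over boxes converge to the
  unconditional sum.\<close>

lemma infsum_outside_box_tendsto_0:
  fixes F :: "nat \<times> nat \<Rightarrow> real"
  assumes "F summable_on {0<..} \<times> {0<..}"
  shows "(\<lambda>D. infsum F ({0<..} \<times> {0<..} - {1..D} \<times> {1..D})) \<longlonglongrightarrow> 0"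
proof -
  let ?P = "{0::nat<..} \<times> {0::nat<..}"
  have "filterlim (\<lambda>D. {1..D} \<times> {1..D}) (finite_subsets_at_top ?P) sequentially"
    unfolding filterlim_finite_subsets_at_top
  proof (intro allI impI)
    fix X :: "(nat \<times> nat) set" assume X: "finite X \<and> X \<subseteq> ?P"
    define N where "N = Max (insert 0 (fst ` X \<union> snd ` X))"
    have N: "x \<le> N \<and> y \<le> N" if "(x, y) \<in> X" for x y
      unfolding N_def using X that by (intro conjI Max_ge) (auto intro: rev_image_eqI)
    have sub: "X \<subseteq> {1..D} \<times> {1..D}" if "D \<ge> N" for D
    proof clarify
      fix x y assume xy: "(x, y) \<in> X"
      then have "x > 0" "y > 0"
        using X by auto
      then show "x \<in> {1..D} \<and> y \<in> {1..D}"
        using N[OF xy] that by auto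
    qed
    show "\<forall>\<^sub>F D in sequentially. finite ({1..D} \<times> {1..D}) \<and>
        X \<subseteq> {1..D} \<times> {1..D} \<and> {1..D} \<times> {1..D} \<subseteq> ?P"
      using eventually_ge_at_top[of N] by eventually_elim (use sub in auto)
  qed
  moreover have "(sum F \<longlongrightarrow> infsum F ?P) (finite_subsets_at_top ?P)"
    using has_sum_infsum[OF assms] by (simp add: has_sum_def)
  ultimately have "(\<lambda>D. sum F ({1..D} \<times> {1..D})) \<longlonglongrightarrow> infsum F ?P"
    by (rule filterlim_compose[rotated])
  then have "(\<lambda>D. infsum F ?P - sum F ({1..D} \<times> {1..D})) \<longlonglongrightarrow> infsum F ?P - infsum F ?P"
    by (intro tendsto_intros)
  moreover have "infsum F (?P - {1..D} \<times> {1..D}) = infsum F ?P - sum F ({1..D} \<times> {1..D})" for D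
    by (subst infsum_Diff) (use assms in auto)
  ultimately show ?thesis by simp
qed

text \<open>The bound, independent of \<open>n\<close>, for the mean square of
  \<open>truncated_sigma A (- c)\<close>.\<close>

definition gcd_sum :: "real \<Rightarrow> nat set \<Rightarrow> real" where
  "gcd_sum c A = (\<Sum>\<^sub>\<infinity>(x, y)\<in>A \<times> A. real (gcd x y) * (real x powr - (c + 1) * real y powr - (c + 1)))"

text \<open>Pairs with both entries above \<open>D\<close> lie outside the box of side
  \<open>D\<close>, so this tail is dominated by the tail of a convergent series.\<close>

lemma gcd_sum_tendsto_0:
  assumes "c > 0"
  shows "(\<lambda>D. gcd_sum c {D<..}) \<longlonglongrightarrow> 0"
proof (rule tendsto_sandwich)
  define F where "F = (\<lambda>(x, y). real (gcd x y) * (real x powr - (c + 1) * real y powr - (c + 1)))"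
  have F: "F summable_on {0<..} \<times> {0<..}"
    unfolding F_def using assms by (intro summable_gcd) auto
  show "\<forall>\<^sub>F D in sequentially. 0 \<le> gcd_sum c {D<..}"
    by (auto simp: gcd_sum_def intro!: always_eventually infsum_nonneg)
  show "\<forall>\<^sub>F D in sequentially. gcd_sum c {D<..} \<le> infsum F ({0<..} \<times> {0<..} - {1..D} \<times> {1..D})"
    unfolding gcd_sum_def F_def[symmetric]
    by (intro always_eventually allI infsum_mono2 summable_on_subset[OF F]) (auto simp: F_def)
  show "(\<lambda>D. infsum F ({0<..} \<times> {0<..} - {1..D} \<times> {1..D})) \<longlonglongrightarrow> 0"
    by (rule infsum_outside_box_tendsto_0[OF F])
qed auto

section \<open>Truncation error of the convolution\<close>

lemma convolution_truncated_sigma_le: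
  assumes "a > 0" "b > 0" "A \<subseteq> {0<..}" "B \<subseteq> {0<..}"
  shows "(\<Sum>k=1..<n. truncated_sigma A (- a) k * truncated_sigma B (- b) (n - k)) \<le>
           real n * sqrt (gcd_sum a A * gcd_sum b B)"
proof -
  let ?f = "truncated_sigma A (- a)" and ?g = "truncated_sigma B (- b)"
  \<comment> \<open>Reflection of the range; after Cauchy-Schwarz both factors are then mean squares
    of the same kind.\<close>
  have "(\<Sum>k=1..<n. (?g (n - k))\<^sup>2) = (\<Sum>k=1..<n. (?g k)\<^sup>2)"
    by (rule sum.reindex_bij_witness[of _ "\<lambda>k. n - k" "\<lambda>k. n - k"]) auto
  then have "(\<Sum>k=1..<n. ?f k * ?g (n - k))\<^sup>2 \<le> (\<Sum>k=1..<n. (?f k)\<^sup>2) * (\<Sum>k=1..<n. (?g k)\<^sup>2)"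
    using Cauchy_Schwarz_ineq_sum[of ?f "\<lambda>k. ?g (n - k)" "{1..<n}"] by simp
  also have "\<dots> \<le> (real n * gcd_sum a A) * (real n * gcd_sum b B)"
    unfolding gcd_sum_def
    by (intro mult_mono sum_truncated_sigma_sq_le assms)
       (auto intro!: sum_nonneg mult_nonneg_nonneg infsum_nonneg)
  also have "\<dots> = (real n)\<^sup>2 * (gcd_sum a A * gcd_sum b B)"
    by (simp add: power2_eq_square)
  finally have "(\<Sum>k=1..<n. ?f k * ?g (n - k)) \<le> sqrt ((real n)\<^sup>2 * (gcd_sum a A * gcd_sum b B))"
    by (rule real_le_rsqrt)
  then show ?thesis
    by (simp add: real_sqrt_mult)
qed

definition weighted_convolution :: "real \<Rightarrow> real \<Rightarrow> nat set \<Rightarrow> nat \<Rightarrow> real" where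
  "weighted_convolution a b A n = (\<Sum>k=1..<n. beta_weight a b (real k / real n) *
     (truncated_sigma A (- a) k * truncated_sigma A (- b) (n - k))) / real n"

text \<open>At \<open>k / n\<close> the weight equals k^a (n - k)^b / n^(a + b); the remaining power
  of \<open>n\<close> comes from taking the mean.\<close>

lemma S_eq_weighted_convolution:
  "S a b n = real n powr (a + b + 1) * weighted_convolution a b {0<..} n"
proof (cases "n = 0")
  case False
  have "divisor_sigma a k * divisor_sigma b (n - k) = real n powr (a + b) *
          (beta_weight a b (real k / real n) *
            (truncated_sigma {0<..} (- a) k * truncated_sigma {0<..} (- b) (n - k)))"
    if "k \<in> {1..<n}" for k
  proof -
    have "real n powr (a + b) * beta_weight a b (real k / real n) = real k powr a * real (n - k) powr b"
    proof -
      have "1 - real k / real n = real (n - k) / real n" "real (n - k) > 0"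
        using that by (auto simp: field_simps of_nat_diff)
      then show ?thesis
        using that by (simp add: beta_weight_def powr_add powr_divide max_def)
    qed
    then show ?thesis
      using that by (simp add: divisor_sigma_eq_truncated)
  qed
  then have "S a b n = (\<Sum>k=1..<n. real n powr (a + b) * (beta_weight a b (real k / real n) *
            (truncated_sigma {0<..} (- a) k * truncated_sigma {0<..} (- b) (n - k))))"
    unfolding S_def by (intro sum.cong refl)
  also have "\<dots> = real n powr (a + b) * (real n * weighted_convolution a b {0<..} n)"
    using False by (simp add: weighted_convolution_def flip: sum_distrib_left)
  finally have "S a b n = real n powr (a + b) * (real n * weighted_convolution a b {0<..} n)" .
  then show ?thesis
    using False by (simp add: powr_add)
qed (simp add: S_def)

text \<open>The difference of products telescopes into two products with one tail factor each. The
  weight is at most 1, so Cauchy-Schwarz bounds both, uniformly in \<open>n\<close>.\<close>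

lemma weighted_convolution_truncate:
  assumes "a > 0" "b > 0"
  shows "\<bar>weighted_convolution a b {0<..} n - weighted_convolution a b {1..D} n\<bar> \<le>
           sqrt (gcd_sum a {D<..} * gcd_sum b {0<..}) + sqrt (gcd_sum a {0<..} * gcd_sum b {D<..})"
proof (cases "n = 0")
  case False
  define f where "f = (\<lambda>A. truncated_sigma A (- a))"
  define g where "g = (\<lambda>A. truncated_sigma A (- b))"
  define w where "w = (\<lambda>k. beta_weight a b (real k / real n))"
  have split: "{0<..} = {1..D} \<union> {D<..}" "{1..D} \<inter> {D<..} = {}"
    by auto
  have nn: "f A k \<ge> 0" "g A k \<ge> 0" for A k
    by (auto simp: f_def g_def truncated_sigma_nonneg)
  have bounds: "0 \<le> w k * (f {0<..} k * g {0<..} (n - k)) - w k * (f {1..D} k * g {1..D} (n - k)) \<and>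
      w k * (f {0<..} k * g {0<..} (n - k)) - w k * (f {1..D} k * g {1..D} (n - k)) \<le>
      f {D<..} k * g {0<..} (n - k) + f {0<..} k * g {D<..} (n - k)"
    if k: "k \<in> {1..<n}" for k
  proof -
    have f: "f {0<..} k = f {1..D} k + f {D<..} k"
      using k unfolding f_def split(1) by (intro truncated_sigma_Un) auto
    have g: "g {0<..} (n - k) = g {1..D} (n - k) + g {D<..} (n - k)"
      using k unfolding g_def split(1) by (intro truncated_sigma_Un) auto
    let ?E = "f {0<..} k * g {0<..} (n - k) - f {1..D} k * g {1..D} (n - k)"
    have E: "?E = f {D<..} k * g {0<..} (n - k) + f {1..D} k * g {D<..} (n - k)"
      unfolding f g by (simp add: algebra_simps)
    have E0: "?E \<ge> 0"
      unfolding E using nn by (intro add_nonneg_nonneg mult_nonneg_nonneg) auto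
    \<comment> \<open>Enlarging the first factor to all divisors leaves only the tail factor
      depending on \<open>D\<close>.\<close>
    have "f {1..D} k * g {D<..} (n - k) \<le> f {0<..} k * g {D<..} (n - k)"
      using nn f by (intro mult_right_mono) auto
    moreover have "w k \<ge> 0" "w k \<le> 1"
      using k assms unfolding w_def by (auto intro!: beta_weight_nonneg beta_weight_le_1)
    then have "w k * ?E \<ge> 0" "w k * ?E \<le> ?E"
      using E0 by (auto intro: mult_left_le_one_le)
    ultimately show ?thesis
      using E by (simp add: right_diff_distrib)
  qed
  let ?d = "\<Sum>k=1..<n. w k * (f {0<..} k * g {0<..} (n - k)) - w k * (f {1..D} k * g {1..D} (n - k))"
  have "?d \<ge> 0"
    using bounds by (intro sum_nonneg) auto
  have "?d \<le> (\<Sum>k=1..<n. f {D<..} k * g {0<..} (n - k)) + (\<Sum>k=1..<n. f {0<..} k * g {D<..} (n - k))"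
    unfolding sum.distrib[symmetric] using bounds by (intro sum_mono) auto
  also have "\<dots> \<le> real n * sqrt (gcd_sum a {D<..} * gcd_sum b {0<..}) +
                    real n * sqrt (gcd_sum a {0<..} * gcd_sum b {D<..})"
    unfolding f_def g_def using assms by (intro add_mono convolution_truncated_sigma_le) auto
  finally have "\<bar>?d\<bar> / real n \<le>
      sqrt (gcd_sum a {D<..} * gcd_sum b {0<..}) + sqrt (gcd_sum a {0<..} * gcd_sum b {D<..})"
    using False \<open>?d \<ge> 0\<close> by (simp add: field_simps)
  moreover have "weighted_convolution a b {0<..} n - weighted_convolution a b {1..D} n = ?d / real n"
    by (simp add: weighted_convolution_def sum_subtractf diff_divide_distrib f_def g_def w_def)
  ultimately show ?thesis by simp
qed (auto simp: weighted_convolution_def gcd_sum_def intro!: add_nonneg_nonneg mult_nonneg_nonneg infsum_nonneg)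

text \<open>For \<open>n = 0\<close> the divisibility condition is void, so \<open>gcd_term a b 0\<close> dominates all \<open>gcd_term a b n\<close>.\<close>

definition gcd_term :: "real \<Rightarrow> real \<Rightarrow> nat \<Rightarrow> nat \<times> nat \<Rightarrow> real" where
  "gcd_term a b n = (\<lambda>(x, y). if gcd x y dvd n
     then real (gcd x y) * (real x powr - (a + 1) * real y powr - (b + 1)) else 0)"

section \<open>Convolution with bounded divisors and its main term\<close>

lemma weighted_convolution_box:
  "weighted_convolution a b {1..D} n = (\<Sum>(d, e)\<in>{1..D} \<times> {1..D}. real d powr - a * real e powr - b *
     ((\<Sum>k | k \<in> {1..<n} \<and> d dvd k \<and> e dvd n - k. beta_weight a b (real k / real n)) / real n))"
proof -
  have tr: "truncated_sigma {1..D} c k = (\<Sum>d=1..D. if d dvd k then real d powr c else 0)" for c k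
    unfolding truncated_sigma_def by (subst sum.inter_filter[symmetric]) (auto intro!: sum.cong)
  have "(\<Sum>k=1..<n. beta_weight a b (real k / real n) *
          (truncated_sigma {1..D} (- a) k * truncated_sigma {1..D} (- b) (n - k))) =
        (\<Sum>k=1..<n. \<Sum>(d,e)\<in>{1..D} \<times> {1..D}. real d powr - a * real e powr - b *
          (if d dvd k \<and> e dvd n - k then beta_weight a b (real k / real n) else 0))"
  proof (rule sum.cong[OF refl])
    fix k
    show "beta_weight a b (real k / real n) *
          (truncated_sigma {1..D} (- a) k * truncated_sigma {1..D} (- b) (n - k)) =
        (\<Sum>(d,e)\<in>{1..D} \<times> {1..D}. real d powr - a * real e powr - b *
          (if d dvd k \<and> e dvd n - k then beta_weight a b (real k / real n) else 0))"
      unfolding tr sum_product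
      unfolding sum.cartesian_product[symmetric] sum_distrib_left
      by (intro sum.cong refl) auto
  qed
  also have "\<dots> = (\<Sum>(d,e)\<in>{1..D} \<times> {1..D}. \<Sum>k=1..<n. real d powr - a * real e powr - b *
          (if d dvd k \<and> e dvd n - k then beta_weight a b (real k / real n) else 0))"
    by (subst sum.swap) (simp add: case_prod_unfold)
  also have "\<dots> = (\<Sum>(d,e)\<in>{1..D} \<times> {1..D}. real d powr - a * real e powr - b *
          (\<Sum>k | k \<in> {1..<n} \<and> d dvd k \<and> e dvd n - k. beta_weight a b (real k / real n)))"
    unfolding sum_distrib_left[symmetric]
    by (intro sum.cong refl) (auto simp flip: sum.inter_filter)
  finally show ?thesis
    unfolding weighted_convolution_def
    by (simp only:) (subst sum_divide_distrib, simp add: case_prod_unfold)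
qed

text \<open>Only finitely many pairs (d, e) occur, so the Riemann sum limits, one for each pair, can
  be added; \<open>weight_div_lcm\<close> turns their densities into
  \<open>gcd_term\<close>.\<close>

lemma weighted_convolution_box_tendsto:
  assumes "a > 0" "b > 0"
  shows "(\<lambda>n. weighted_convolution a b {1..D} n
            - Beta (a + 1) (b + 1) * sum (gcd_term a b n) ({1..D} \<times> {1..D})) \<longlonglongrightarrow> 0"
proof -
  let ?T = "\<lambda>d e n. (\<Sum>k | k \<in> {1..<n} \<and> d dvd k \<and> e dvd n - k. beta_weight a b (real k / real n)) / real n
              - (if gcd d e dvd n then Beta (a + 1) (b + 1) / real (lcm d e) else 0)"
  have "(\<lambda>n. \<Sum>(d, e)\<in>{1..D} \<times> {1..D}. real d powr - a * real e powr - b * ?T d e n) \<longlonglongrightarrow>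
          (\<Sum>(d, e)\<in>{1..D} \<times> {1..D}. real d powr - a * real e powr - b * 0)"
    unfolding case_prod_unfold using assms
    by (intro tendsto_sum tendsto_mult_left two_divisibility_riemann_sum continuous_beta_weight
          beta_weight_eq_0 has_integral_beta_weight) auto
  moreover have "gcd_term a b n (d, e) = real d powr - a * real e powr - b *
      (if gcd d e dvd n then 1 / real (lcm d e) else 0)" if "d > 0" "e > 0" for d e n
    using weight_div_lcm[OF that, of a b] by (simp add: gcd_term_def)
  then have "weighted_convolution a b {1..D} n
            - Beta (a + 1) (b + 1) * sum (gcd_term a b n) ({1..D} \<times> {1..D}) =
      (\<Sum>(d, e)\<in>{1..D} \<times> {1..D}. real d powr - a * real e powr - b * ?T d e n)" for n
    unfolding weighted_convolution_box sum_distrib_left sum_subtractf[symmetric]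
    by (intro sum.cong refl) (auto simp: algebra_simps)
  ultimately show ?thesis by simp
qed

text \<open>The missing part is the tail of the series for \<open>n\<close>, dominated by the tail
  for 0. Hence the bound is the same for all \<open>n\<close>.\<close>

lemma gcd_term_truncate:
  assumes "a > 0" "b > 0" "n > 0"
  shows "\<bar>divisor_sigma (- (a + b + 1)) n * (zeta (a + 1) * zeta (b + 1) / zeta (a + b + 2))
            - sum (gcd_term a b n) ({1..D} \<times> {1..D})\<bar>
           \<le> infsum (gcd_term a b 0) ({0<..} \<times> {0<..} - {1..D} \<times> {1..D})"
proof -
  let ?P = "{0::nat<..} \<times> {0::nat<..}" and ?B = "{1..D} \<times> {1..D}"
  have eq: "1 - (a + 1) - (b + 1) = - (a + b + 1)" "a + 1 + (b + 1) = a + b + 2"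
    by auto
  have hs: "(gcd_term a b n has_sum divisor_sigma (- (a + b + 1)) n *
          (zeta (a + 1) * zeta (b + 1) / zeta (a + b + 2))) ?P"
    using has_sum_gcd_dvd[of "a + 1" "b + 1" n] assms unfolding eq gcd_term_def by simp
  have tail: "(gcd_term a b n has_sum (divisor_sigma (- (a + b + 1)) n *
          (zeta (a + 1) * zeta (b + 1) / zeta (a + b + 2)) - sum (gcd_term a b n) ?B)) (?P - ?B)"
    by (intro has_sum_Diff hs has_sum_finite) auto
  have sm: "gcd_term a b 0 summable_on ?P"
    using summable_gcd[of "a + 1" "b + 1"] assms by (simp add: gcd_term_def)
  have le: "gcd_term a b n p \<le> gcd_term a b 0 p" "gcd_term a b n p \<ge> 0" for p
    by (auto simp: gcd_term_def split: prod.split)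
  have "infsum (gcd_term a b n) (?P - ?B) \<le> infsum (gcd_term a b 0) (?P - ?B)"
    using tail le by (intro infsum_mono summable_on_subset[OF sm]) (auto simp: has_sum_iff)
  moreover have "infsum (gcd_term a b n) (?P - ?B) \<ge> 0"
    using le by (intro infsum_nonneg) auto
  ultimately show ?thesis
    using tail by (simp add: has_sum_iff)
qed

section \<open>Removal of the cutoff\<close>

lemma weighted_convolution_tendsto:
  assumes "a > 0" "b > 0"
  shows "(\<lambda>n. weighted_convolution a b {0<..} n - Beta (a + 1) (b + 1) *
            (divisor_sigma (- (a + b + 1)) n * (zeta (a + 1) * zeta (b + 1) / zeta (a + b + 2)))) \<longlonglongrightarrow> 0"
    (is "(\<lambda>n. ?R n - ?\<beta> * ?M n) \<longlonglongrightarrow> 0")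
proof (rule tendstoI)
  fix \<epsilon> :: real assume \<epsilon>: "\<epsilon> > 0"
  have \<beta>: "?\<beta> > 0"
    using assms by (auto simp: Beta_def intro!: divide_pos_pos mult_pos_pos Gamma_real_pos)
  \<comment> \<open>Both truncation errors together, of the convolution and of the main term. As
    they do not involve \<open>n\<close>, the cutoff \<open>D\<close> is fixed first and
    \<open>n\<close> is taken large afterwards.\<close>
  let ?\<delta> = "\<lambda>D. sqrt (gcd_sum a {D<..} * gcd_sum b {0<..}) + sqrt (gcd_sum a {0<..} * gcd_sum b {D<..}) +
              ?\<beta> * infsum (gcd_term a b 0) ({0<..} \<times> {0<..} - {1..D} \<times> {1..D})"
  have "?\<delta> \<longlonglongrightarrow> sqrt (0 * gcd_sum b {0<..}) + sqrt (gcd_sum a {0<..} * 0) + ?\<beta> * 0"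
    using summable_gcd[of "a + 1" "b + 1"] assms
    by (intro tendsto_intros gcd_sum_tendsto_0 infsum_outside_box_tendsto_0) (auto simp: gcd_term_def)
  then have "?\<delta> \<longlonglongrightarrow> 0" by simp
  then have "\<forall>\<^sub>F D in sequentially. ?\<delta> D < \<epsilon> / 2"
    using \<epsilon> by (intro order_tendstoD) auto
  then obtain D where D: "?\<delta> D < \<epsilon> / 2"
    using eventually_happens'[OF sequentially_bot] by blast
  let ?RD = "weighted_convolution a b {1..D}" and ?MD = "\<lambda>n. sum (gcd_term a b n) ({1..D} \<times> {1..D})"
  have "\<forall>\<^sub>F n in sequentially. dist (?RD n - ?\<beta> * ?MD n) 0 < \<epsilon> / 2"
    using \<epsilon> by (intro tendstoD[OF weighted_convolution_box_tendsto] assms) auto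
  then show "\<forall>\<^sub>F n in sequentially. dist (?R n - ?\<beta> * ?M n) 0 < \<epsilon>"
    using eventually_gt_at_top[of 0]
  proof eventually_elim
    case (elim n)
    have "\<bar>?\<beta> * ?M n - ?\<beta> * ?MD n\<bar> = ?\<beta> * \<bar>?M n - ?MD n\<bar>"
      using \<beta> by (simp only: right_diff_distrib[symmetric] abs_mult abs_of_pos)
    also have "\<dots> \<le> ?\<beta> * infsum (gcd_term a b 0) ({0<..} \<times> {0<..} - {1..D} \<times> {1..D})"
      using \<beta> by (intro mult_left_mono gcd_term_truncate assms elim(2)) auto
    finally show ?case
      using D elim(1) weighted_convolution_truncate[OF assms, of n D]
      by (simp only: dist_real_def)
  qed
qed

section \<open>From a null difference to a ratio tending to 1\<close>

theorem theorem3p1: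
  fixes a b :: real
  assumes "a > 0" and "b > 0"
  shows "(\<lambda>n::nat. S a b n) \<sim>[at_top]
    (\<lambda>n. (Gamma (a + 1) * Gamma (b + 1) / Gamma (a + b + 2))
       * (zeta (a + 1) * zeta (b + 1) / zeta (a + b + 2))
       * divisor_sigma (a + b + 1) n)"
proof (rule asymp_equivI')
  define \<beta> where "\<beta> = Beta (a + 1) (b + 1)"
  define K where "K = zeta (a + 1) * zeta (b + 1) / zeta (a + b + 2)"
  define R where "R = weighted_convolution a b {0<..}"
  define M where "M = (\<lambda>n. divisor_sigma (- (a + b + 1)) n * K)"
  have \<beta>_eq: "Gamma (a + 1) * Gamma (b + 1) / Gamma (a + b + 2) = \<beta>"
    by (simp add: \<beta>_def Beta_def add_ac)
  have \<beta>: "\<beta> > 0"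
    unfolding \<beta>_def using assms by (auto simp: Beta_def intro!: divide_pos_pos mult_pos_pos Gamma_real_pos)
  have "zeta s > 0" if "s > 1" for s
    using zeta_ge_1[OF that] by simp
  then have K: "K > 0"
    unfolding K_def using assms by (intro divide_pos_pos mult_pos_pos) auto
  \<comment> \<open>The divisor 1 alone contributes 1. This positive lower bound lets the null
    difference be divided by the main term.\<close>
  have M: "M n \<ge> K" if "n > 0" for n
    using divisor_sigma_ge_1[OF that] K by (simp add: M_def)
  have lim: "(\<lambda>n. R n - \<beta> * M n) \<longlonglongrightarrow> 0"
    using weighted_convolution_tendsto[OF assms] by (simp add: R_def \<beta>_def M_def K_def)
  have "(\<lambda>n. (R n - \<beta> * M n) / (\<beta> * M n)) \<longlonglongrightarrow> 0"
  proof (rule Lim_null_comparison)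
    show "\<forall>\<^sub>F n in sequentially. norm ((R n - \<beta> * M n) / (\<beta> * M n)) \<le> \<bar>R n - \<beta> * M n\<bar> / (\<beta> * K)"
      using eventually_gt_at_top[of 0]
    proof eventually_elim
      case (elim n)
      have "0 < \<beta> * K" "\<beta> * K \<le> \<beta> * M n"
        using \<beta> K M[OF elim] by auto
      then show ?case
        unfolding real_norm_def abs_divide abs_of_pos[OF less_le_trans[OF \<open>0 < \<beta> * K\<close> \<open>\<beta> * K \<le> \<beta> * M n\<close>]]
        using \<beta> K M[OF elim]
        by (intro divide_left_mono mult_pos_pos) auto
    qed
    show "(\<lambda>n. \<bar>R n - \<beta> * M n\<bar> / (\<beta> * K)) \<longlonglongrightarrow> 0"
      by (intro tendsto_divide_zero tendsto_rabs_zero lim)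
  qed
  then have "(\<lambda>n. 1 + (R n - \<beta> * M n) / (\<beta> * M n)) \<longlonglongrightarrow> 1 + 0"
    by (intro tendsto_intros)
  also have "?this \<longleftrightarrow> (\<lambda>n. S a b n / (Gamma (a + 1) * Gamma (b + 1) / Gamma (a + b + 2)
       * (zeta (a + 1) * zeta (b + 1) / zeta (a + b + 2)) * divisor_sigma (a + b + 1) n)) \<longlonglongrightarrow> 1 + 0"
  proof (rule tendsto_cong)
    show "\<forall>\<^sub>F n in sequentially. 1 + (R n - \<beta> * M n) / (\<beta> * M n) =
        S a b n / (Gamma (a + 1) * Gamma (b + 1) / Gamma (a + b + 2)
       * (zeta (a + 1) * zeta (b + 1) / zeta (a + b + 2)) * divisor_sigma (a + b + 1) n)"
      using eventually_gt_at_top[of 0]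
    proof eventually_elim
      case (elim n)
      have "\<beta> \<noteq> 0" "M n \<noteq> 0"
        using \<beta> K M[OF elim] by auto
      then have "1 + (R n - \<beta> * M n) / (\<beta> * M n) = R n / (\<beta> * M n)"
        by (simp add: diff_divide_distrib)
      \<comment> \<open>The common factor turns \<open>R n\<close> back into \<open>S a b n\<close>
        and reflects the exponent of the divisor sum from \<open>- (a + b + 1)\<close> to
        \<open>a + b + 1\<close>.\<close>
      also have "\<dots> = (real n powr (a + b + 1) * R n) / (real n powr (a + b + 1) * (\<beta> * M n))"
        using elim by simp
      also have "real n powr (a + b + 1) * (\<beta> * M n) = \<beta> * K * divisor_sigma (a + b + 1) n"
        unfolding divisor_sigma_uminus[OF elim, of "a + b + 1"] by (simp add: M_def)
      finally show ?case
        unfolding \<beta>_eq K_def[symmetric] S_eq_weighted_convolution R_def .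
    qed
  qed
  finally show "(\<lambda>n. S a b n / (Gamma (a + 1) * Gamma (b + 1) / Gamma (a + b + 2)
       * (zeta (a + 1) * zeta (b + 1) / zeta (a + b + 2)) * divisor_sigma (a + b + 1) n)) \<longlonglongrightarrow> 1"
    by simp
qed

end
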